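(* Let $A$ be a commutative ring with identity. The connected components of $\operatorname{Sq} A$ are precisely the sets of the form $\mathcal{V}(M)$, where $M$ is a max-regular ideal of $A$.
   Context: A proper ideal $\mathfrak{q}$ of $A$ is called quasi-prime if whenever $fg\in\mathfrak{q}$ with $f,g\in A$, then $f\in\sqrt{\mathfrak{q}}$ or $g\in\sqrt{\mathfrak{q}}$. The quasi-prime spectrum $\operatorname{Sq} A$ is the set of all quasi-prime ideals of $A$, with the topology having as basis of opens the sets $U_f=\{\mathfrak{q}\in\operatorname{Sq} A: \mathfrak{q}\cap S_f=\emptyset\}$ for $f\in A$, where $S_f=\{f^i : i\ge 0\}=\{1,f,f^2,\dots\}$. For an ideal $I$ of $A$, $\mathcal{V}(I)=\{\mathfrak{q}\in\operatorname{Sq} A: I\subseteq\sqrt{\mathfrak{q}}\}$. An ideal of $A$ is called regular if it is generated by a set of idempotent elements of $A$. A max-regular ideal of $A$ is a maximal element, with respect to inclusion, of the set of proper regular ideals of $A$. *)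

theory Defs
  imports "HOL-Analysis.Analysis" "HOL-Algebra.Algebra"
begin

definition ideal_radical :: "('a, 'm) ring_scheme \<Rightarrow> 'a set \<Rightarrow> 'a set" where
  "ideal_radical A I = {f \<in> carrier A. \<exists>n::nat. n > 0 \<and> f [^]\<^bsub>A\<^esub> n \<in> I}"

definition quasi_prime :: "('a, 'm) ring_scheme \<Rightarrow> 'a set \<Rightarrow> bool" where
  "quasi_prime A q \<longleftrightarrow>
     ideal q A \<and> q \<noteq> carrier A \<and>
     (\<forall>f\<in>carrier A. \<forall>g\<in>carrier A. f \<otimes>\<^bsub>A\<^esub> g \<in> q \<longrightarrow> f \<in> ideal_radical A q \<or> g \<in> ideal_radical A q)"

definition Sq :: "('a, 'm) ring_scheme \<Rightarrow> 'a set set" where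
  "Sq A = {q. quasi_prime A q}"

definition powers :: "('a, 'm) ring_scheme \<Rightarrow> 'a \<Rightarrow> 'a set" where
  "powers A f = {f [^]\<^bsub>A\<^esub> i |i::nat. True}"

definition Sq_basic_open :: "('a, 'm) ring_scheme \<Rightarrow> 'a \<Rightarrow> 'a set set" where
  "Sq_basic_open A f = {q \<in> Sq A. q \<inter> powers A f = {}}"

text \<open>The constant \<^const>\<open>topology\<close> is only meaningful on families satisfying
  \<^const>\<open>istopology\<close>; for a commutative ring this is shown in
  \<open>istopology_Sq\<close> below.\<close>

definition Sq_topology :: "('a, 'm) ring_scheme \<Rightarrow> 'a set topology" where
  "Sq_topology A =
     topology (arbitrary union_of (\<lambda>U. \<exists>f\<in>carrier A. U = Sq_basic_open A f))"

definition Sq_V :: "('a, 'm) ring_scheme \<Rightarrow> 'a set \<Rightarrow> 'a set set" where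
  "Sq_V A I = {q \<in> Sq A. I \<subseteq> ideal_radical A q}"

definition idempotents :: "('a, 'm) ring_scheme \<Rightarrow> 'a set" where
  "idempotents A = {e \<in> carrier A. e \<otimes>\<^bsub>A\<^esub> e = e}"

definition regular_ideal :: "('a, 'm) ring_scheme \<Rightarrow> 'a set \<Rightarrow> bool" where
  "regular_ideal A I \<longleftrightarrow> (\<exists>E. E \<subseteq> idempotents A \<and> I = genideal A E)"

definition max_regular_ideal :: "('a, 'm) ring_scheme \<Rightarrow> 'a set \<Rightarrow> bool" where
  "max_regular_ideal A M \<longleftrightarrow>
     regular_ideal A M \<and> M \<noteq> carrier A \<and>
     (\<forall>J. regular_ideal A J \<and> J \<noteq> carrier A \<and> M \<subseteq> J \<longrightarrow> J = M)"

lemma Sq_basic_open_Int: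
  assumes "cring A" and f: "f \<in> carrier A" and g: "g \<in> carrier A"
  shows "Sq_basic_open A f \<inter> Sq_basic_open A g = Sq_basic_open A (f \<otimes>\<^bsub>A\<^esub> g)"
proof -
  interpret cring A by fact
  have "(\<forall>i::nat. f [^]\<^bsub>A\<^esub> i \<notin> q) \<and> (\<forall>i::nat. g [^]\<^bsub>A\<^esub> i \<notin> q) \<longleftrightarrow>
        (\<forall>i::nat. (f \<otimes>\<^bsub>A\<^esub> g) [^]\<^bsub>A\<^esub> i \<notin> q)" if q: "quasi_prime A q" for q
  proof -
    interpret q: ideal q A using q by (simp add: quasi_prime_def)
    have pw: "(f \<otimes>\<^bsub>A\<^esub> g) [^]\<^bsub>A\<^esub> i = f [^]\<^bsub>A\<^esub> i \<otimes>\<^bsub>A\<^esub> g [^]\<^bsub>A\<^esub> i" for i :: nat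
      using f g by (simp add: nat_pow_distrib)
    have "(\<exists>i::nat. f [^]\<^bsub>A\<^esub> i \<in> q) \<or> (\<exists>i::nat. g [^]\<^bsub>A\<^esub> i \<in> q)"
      if "f [^]\<^bsub>A\<^esub> i \<otimes>\<^bsub>A\<^esub> g [^]\<^bsub>A\<^esub> i \<in> q" for i :: nat
    proof -
      have "f [^]\<^bsub>A\<^esub> i \<in> ideal_radical A q \<or> g [^]\<^bsub>A\<^esub> i \<in> ideal_radical A q"
        using q that f g unfolding quasi_prime_def by blast
      then show ?thesis
        using f g by (auto simp: ideal_radical_def nat_pow_pow)
    qed
    moreover have "f [^]\<^bsub>A\<^esub> i \<otimes>\<^bsub>A\<^esub> g [^]\<^bsub>A\<^esub> i \<in> q"
      if "f [^]\<^bsub>A\<^esub> i \<in> q \<or> g [^]\<^bsub>A\<^esub> i \<in> q" for i :: nat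
      using that f g q.I_l_closed q.I_r_closed by auto
    ultimately show ?thesis unfolding pw by blast
  qed
  moreover have "q \<in> Sq_basic_open A h \<longleftrightarrow> quasi_prime A q \<and> (\<forall>i::nat. h [^]\<^bsub>A\<^esub> i \<notin> q)" for q h
    unfolding Sq_basic_open_def Sq_def powers_def by blast
  ultimately show ?thesis
    by (simp add: set_eq_iff) metis
qed

lemma istopology_Sq:
  assumes "cring A"
  shows "istopology (arbitrary union_of (\<lambda>U. \<exists>f\<in>carrier A. U = Sq_basic_open A f))"
proof (rule istopology_base)
  fix S T
  assume "\<exists>f\<in>carrier A. S = Sq_basic_open A f" "\<exists>f\<in>carrier A. T = Sq_basic_open A f"
  then obtain f g where fg: "f \<in> carrier A" "g \<in> carrier A"
    "S = Sq_basic_open A f" "T = Sq_basic_open A g" by blast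
  interpret cring A by fact
  show "\<exists>h\<in>carrier A. S \<inter> T = Sq_basic_open A h"
    using Sq_basic_open_Int[OF assms fg(1,2)] fg by (metis m_closed)
qed

lemma openin_Sq_topology:
  assumes "cring A"
  shows "openin (Sq_topology A) =
    arbitrary union_of (\<lambda>U. \<exists>f\<in>carrier A. U = Sq_basic_open A f)"
  unfolding Sq_topology_def by (rule topology_inverse'[OF istopology_Sq[OF assms]])

lemma topspace_Sq_topology:
  assumes "cring A"
  shows "topspace (Sq_topology A) = Sq A"
proof -
  interpret cring A by fact
  have "powers A \<one>\<^bsub>A\<^esub> = {\<one>\<^bsub>A\<^esub>}"
    by (simp add: powers_def)
  moreover have "\<one>\<^bsub>A\<^esub> \<notin> q" if "q \<in> Sq A" for q
    using that ideal.one_imp_carrier[of q A] by (auto simp: Sq_def quasi_prime_def)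
  ultimately have "Sq_basic_open A \<one>\<^bsub>A\<^esub> = Sq A"
    by (auto simp: Sq_basic_open_def)
  then have "\<exists>f\<in>carrier A. Sq A = Sq_basic_open A f"
    by blast
  then have "openin (Sq_topology A) (Sq A)"
    unfolding openin_Sq_topology[OF assms] by (rule arbitrary_union_of_inc)
  moreover have "topspace (Sq_topology A) \<subseteq> Sq A"
  proof -
    have "(arbitrary union_of (\<lambda>U. \<exists>f\<in>carrier A. U = Sq_basic_open A f)) (topspace (Sq_topology A))"
      using openin_topspace[of "Sq_topology A"] by (simp add: openin_Sq_topology[OF assms])
    moreover have "Sq_basic_open A f \<subseteq> Sq A" for f
      by (simp add: Sq_basic_open_def)
    ultimately show ?thesis
      unfolding arbitrary_union_of_alt by blast
  qed
  ultimately show ?thesis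
    by (simp add: openin_subset subset_antisym)
qed

end

theory Submission
  imports Defs
begin

text \<open>Idempotents cut the quasi-prime spectrum into clopen pieces. For an idempotent \<open>e\<close> the product of
  \<open>e\<close> and \<open>1 - e\<close> is \<open>0\<close>, so a quasi-prime ideal contains a power of one of them, hence that element
  itself, and it cannot contain both. The sets \<open>{q. e \<in> q}\<close> and \<open>{q. 1 - e \<in> q}\<close> are therefore
  complementary basic open sets, and all members of a connected set contain the same idempotents.

  Let \<open>J(q)\<close> (\<open>idempotent_core q\<close> below) be the ideal generated by the idempotents in \<open>q\<close>. The dichotomy
  between \<open>e\<close> and \<open>1 - e\<close> shows that the max-regular ideals are exactly the ideals \<open>J(q)\<close>
  (\<open>max_regular_iff_idempotent_core\<close>). Since \<open>q'\<close> lies in \<open>\<V>(J(q))\<close> iff it contains every idempotent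
  of \<open>q\<close>, the component of \<open>q\<close> is contained in \<open>\<V>(J(q))\<close>, and what remains is that \<open>\<V>(J(q))\<close> is
  connected (\<open>connectedin_Sq_V_idempotent_core\<close>).

  Whether \<open>q\<close> lies in an open set depends only on its radical, which is prime, so a separation of
  \<open>\<V>(M)\<close>, \<open>M = J(q)\<close>, by \<open>U\<close> and \<open>W\<close> may be tested on prime ideals. The intersections of
  the primes of \<open>\<V>(M)\<close> outside \<open>U\<close> and outside \<open>W\<close> are comaximal, which yields \<open>a + b = 1\<close> where every
  prime of \<open>\<V>(M)\<close> contains \<open>a\<close> or \<open>b\<close>, so that a power of \<open>ab\<close> lies in \<open>M\<close>. Modulo \<open>M\<close> the element
  \<open>a\<close> thus determines a clopen set, and idempotents lift along a regular ideal
  (\<open>lift_idempotent\<close>): there is a genuine idempotent \<open>u\<close> lying in the same primes above \<open>M\<close> as \<open>a\<close>.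
  But \<open>u\<close> or \<open>1 - u\<close> is in \<open>M\<close>, so one side of the separation is empty.

  All existence statements about prime ideals come from one application of Zorn's lemma
  (\<open>exists_prime_avoiding_powers\<close>).\<close>

section \<open>Enough prime ideals\<close>

lemma (in primeideal) pow_mem_iff:
  assumes "x \<in> carrier R" "n > (0::nat)"
  shows "x [^] n \<in> I \<longleftrightarrow> x \<in> I"
  using assms(2)
proof (induction n rule: nat_induct_non_zero)
  case 1
  then show ?case using assms(1) by simp
next
  case (Suc n)
  then show ?case using assms(1) I_prime[of "x [^] n" x] I_l_closed[of x "x [^] n"] by auto
qed

context cring
begin

lemma prime_not_one:
  assumes "primeideal p R" shows "\<one> \<notin> p"
  using assms ideal.one_imp_carrier primeideal.I_notcarr primeideal.axioms(1) by blast

lemma ideal_sum_one: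
  assumes "ideal I R" "x \<in> I" "y \<in> I" "x \<oplus> y = \<one>"
  shows "I = carrier R"
  using assms by (metis additive_subgroup.a_closed ideal.axioms(1) ideal.one_imp_carrier)

text \<open>An ideal that is maximal among those above \<open>I\<close> without a power of \<open>x\<close> is prime: enlarging it by
  \<open>a\<close> or by \<open>b\<close> produces powers of \<open>x\<close>, and the product of two such powers would lie in it if \<open>ab\<close> did.
  For \<open>x = 1\<close> this says that a proper ideal lies in a prime ideal.\<close>

lemma exists_prime_avoiding_powers:
  assumes I: "ideal I R" and x: "x \<in> carrier R" and avoid: "\<And>n::nat. x [^] n \<notin> I"
  shows "\<exists>p. primeideal p R \<and> I \<subseteq> p \<and> x \<notin> p"
proof -
  define S where "S = {J. ideal J R \<and> I \<subseteq> J \<and> (\<forall>n::nat. x [^] n \<notin> J)}"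
  have "\<exists>P\<in>S. \<forall>J\<in>S. P \<subseteq> J \<longrightarrow> J = P"
  proof (rule subset_Zorn_nonempty)
    show "S \<noteq> {}" using I avoid by (auto simp: S_def)
    fix C assume C: "C \<noteq> {}" "subset.chain S C"
    then have "C \<subseteq> S" and "subset.chain {I. ideal I R} C"
      by (auto simp: S_def pred_on.chain_def)
    then have "ideal (\<Union>C) R"
      using chain_Union_is_ideal[of C] C(1) by simp
    then show "\<Union>C \<in> S"
      using \<open>C \<subseteq> S\<close> C(1) unfolding S_def by blast
  qed
  then obtain P where "P \<in> S" and max: "\<And>J. J \<in> S \<Longrightarrow> P \<subseteq> J \<Longrightarrow> J = P"
    by blast
  then have P: "ideal P R" "I \<subseteq> P" "\<And>n::nat. x [^] n \<notin> P"
    by (auto simp: S_def)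
  interpret P: ideal P R by fact
  have extend: "\<exists>n::nat. \<exists>u\<in>P. \<exists>r\<in>carrier R. x [^] n = u \<oplus> r \<otimes> a"
    if a: "a \<in> carrier R" "a \<notin> P" for a
  proof -
    let ?J = "P <+>\<^bsub>R\<^esub> PIdl a"
    have J: "ideal ?J R"
      using add_ideals P(1) cgenideal_ideal a(1) by blast
    have mem: "y \<in> ?J \<longleftrightarrow> (\<exists>u\<in>P. \<exists>r\<in>carrier R. y = u \<oplus> r \<otimes> a)" for y
      by (auto simp: set_add_def' cgenideal_def)
    have "u \<in> ?J" if "u \<in> P" for u
      unfolding mem using that a(1) by (intro bexI[of _ u] bexI[of _ \<zero>]) auto
    then have "P \<subseteq> ?J" by blast
    moreover have "a \<in> ?J"
      unfolding mem using a(1) by (intro bexI[of _ \<zero>] bexI[of _ \<one>]) auto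
    ultimately have "?J \<notin> S" using max a(2) by blast
    then show ?thesis
      using J \<open>P \<subseteq> ?J\<close> P(2) mem by (auto simp: S_def)
  qed
  have "primeideal P R"
  proof (rule primeidealI[OF P(1) is_cring])
    show "carrier R \<noteq> P" using P(3)[of 0] by auto
    fix a b assume ab: "a \<in> carrier R" "b \<in> carrier R" "a \<otimes> b \<in> P"
    show "a \<in> P \<or> b \<in> P"
    proof (rule ccontr)
      assume "\<not> (a \<in> P \<or> b \<in> P)"
      then obtain n m :: nat and u v r s where
        uv: "u \<in> P" "v \<in> P" and rs: "r \<in> carrier R" "s \<in> carrier R"
        and eq: "x [^] n = u \<oplus> r \<otimes> a" "x [^] m = v \<oplus> s \<otimes> b"
        using extend ab(1,2) by metis
      have c: "u \<in> carrier R" "v \<in> carrier R" using uv P.Icarr by auto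
      have "x [^] (n + m) = (u \<oplus> r \<otimes> a) \<otimes> (v \<oplus> s \<otimes> b)"
        using x eq by (simp flip: nat_pow_mult)
      also have "\<dots> = (v \<oplus> s \<otimes> b) \<otimes> u \<oplus> ((r \<otimes> a) \<otimes> v \<oplus> (r \<otimes> s) \<otimes> (a \<otimes> b))"
        using c rs ab(1,2) by algebra
      also have "\<dots> \<in> P"
        using c rs uv ab P.I_l_closed[of u "v \<oplus> s \<otimes> b"] P.I_l_closed[of v "r \<otimes> a"]
          P.I_l_closed[of "a \<otimes> b" "r \<otimes> s"] by (intro P.a_closed) auto
      finally show False using P(3) by blast
    qed
  qed
  moreover have "x \<notin> P" using P(3)[of 1] x by simp
  ultimately show ?thesis using P(2) by blast
qed

text \<open>Otherwise \<open>I + J\<close> is proper and some prime ideal contains it.\<close>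

lemma comaximal_if_no_common_prime:
  assumes "ideal I R" "ideal J R"
    and no: "\<And>p. \<lbrakk>primeideal p R; I \<subseteq> p; J \<subseteq> p\<rbrakk> \<Longrightarrow> False"
  obtains a b where "a \<in> I" "b \<in> J" "a \<oplus> b = \<one>"
proof (cases "\<exists>a\<in>I. \<exists>b\<in>J. a \<oplus> b = \<one>")
  case True
  then show ?thesis using that by blast
next
  case False
  have mem: "x \<in> I <+>\<^bsub>R\<^esub> J \<longleftrightarrow> (\<exists>a\<in>I. \<exists>b\<in>J. x = a \<oplus> b)" for x
    by (simp add: set_add_def')
  have "ideal (I <+>\<^bsub>R\<^esub> J) R" by (rule add_ideals[OF assms(1,2)])
  moreover have "\<one> \<notin> I <+>\<^bsub>R\<^esub> J" unfolding mem using False by metis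
  ultimately obtain p where p: "primeideal p R" "I <+>\<^bsub>R\<^esub> J \<subseteq> p"
    using exists_prime_avoiding_powers[of "I <+>\<^bsub>R\<^esub> J" \<one>] by auto
  interpret I: ideal I R by fact
  interpret J: ideal J R by fact
  have "x \<in> I <+>\<^bsub>R\<^esub> J" if "x \<in> I" for x
    unfolding mem using that I.Icarr by (intro bexI[of _ x] bexI[of _ \<zero>]) auto
  moreover have "x \<in> I <+>\<^bsub>R\<^esub> J" if "x \<in> J" for x
    unfolding mem using that J.Icarr by (intro bexI[of _ x] bexI[of _ \<zero>]) auto
  ultimately show ?thesis using no[OF p(1)] p(2) by blast
qed

text \<open>This description also shows that the radical is an ideal, without any binomial expansion.\<close>

lemma ideal_radical_eq_Inter_primes:
  assumes I: "ideal I R" and "I \<noteq> carrier R"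
  shows "ideal_radical R I = \<Inter>{p. primeideal p R \<and> I \<subseteq> p}"
    and "{p. primeideal p R \<and> I \<subseteq> p} \<noteq> {}"
proof -
  have not_one: "\<one> \<notin> I" using assms ideal.one_imp_carrier by blast
  then show ne: "{p. primeideal p R \<and> I \<subseteq> p} \<noteq> {}"
    using exists_prime_avoiding_powers[OF I, of \<one>] by auto
  show "ideal_radical R I = \<Inter>{p. primeideal p R \<and> I \<subseteq> p}"
  proof (intro equalityI subsetI InterI)
    fix x p assume "x \<in> ideal_radical R I" "p \<in> {p. primeideal p R \<and> I \<subseteq> p}"
    then show "x \<in> p" by (auto simp: ideal_radical_def primeideal.pow_mem_iff)
  next
    fix x assume x: "x \<in> \<Inter>{p. primeideal p R \<and> I \<subseteq> p}"
    obtain p where p: "primeideal p R" "I \<subseteq> p" using ne by blast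
    then have "x \<in> p" using x by blast
    then have "x \<in> carrier R" by (rule ideal.Icarr[OF primeideal.axioms(1)[OF p(1)]])
    moreover from this obtain n :: nat where n: "x [^] n \<in> I"
      using exists_prime_avoiding_powers[OF I, of x] x by blast
    moreover from n have "n \<noteq> 0" using not_one by (intro notI) simp
    ultimately show "x \<in> ideal_radical R I" by (auto simp: ideal_radical_def)
  qed
qed

section \<open>Quasi-prime ideals and their radicals\<close>

lemma Sq_ideal: "q \<in> Sq R \<Longrightarrow> ideal q R"
  and Sq_proper: "q \<in> Sq R \<Longrightarrow> q \<noteq> carrier R"
  by (auto simp: Sq_def quasi_prime_def)

lemma prime_radical:
  assumes "primeideal p R" shows "ideal_radical R p = p"
proof -
  interpret primeideal p R by fact
  show ?thesis using pow_mem_iff Icarr by (auto simp: ideal_radical_def intro!: exI[of _ 1])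
qed

lemma prime_in_Sq:
  assumes "primeideal p R" shows "p \<in> Sq R"
proof -
  interpret primeideal p R by fact
  show ?thesis
    using I_notcarr I_prime is_ideal prime_radical[OF assms]
    by (auto simp: Sq_def quasi_prime_def)
qed

lemma quasi_prime_radical_prime:
  assumes q: "q \<in> Sq R"
  shows "primeideal (ideal_radical R q) R"
proof (rule primeidealI[OF _ is_cring])
  note I = Sq_ideal[OF q] Sq_proper[OF q]
  show "ideal (ideal_radical R q) R"
    unfolding ideal_radical_eq_Inter_primes(1)[OF I]
    by (rule i_Intersect[OF _ ideal_radical_eq_Inter_primes(2)[OF I]])
      (simp add: primeideal.axioms(1))
  have "\<one> \<notin> ideal_radical R q"
    using I ideal.one_imp_carrier by (auto simp: ideal_radical_def)
  then show "carrier R \<noteq> ideal_radical R q" by auto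
  fix a b assume ab: "a \<in> carrier R" "b \<in> carrier R" "a \<otimes> b \<in> ideal_radical R q"
  then obtain n :: nat where n: "n > 0" "a [^] n \<otimes> b [^] n \<in> q"
    by (auto simp: ideal_radical_def nat_pow_distrib)
  then have "a [^] n \<in> ideal_radical R q \<or> b [^] n \<in> ideal_radical R q"
    using q ab by (auto simp: Sq_def quasi_prime_def)
  then show "a \<in> ideal_radical R q \<or> b \<in> ideal_radical R q"
    using ab n(1) unfolding ideal_radical_def
    by (simp add: nat_pow_pow) (metis nat_0_less_mult_iff)
qed

lemma Sq_basic_open_iff:
  assumes "f \<in> carrier R"
  shows "q \<in> Sq_basic_open R f \<longleftrightarrow> q \<in> Sq R \<and> f \<notin> ideal_radical R q"
proof (cases "q \<in> Sq R")
  case True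
  then have "f [^] (0::nat) \<notin> q"
    using Sq_ideal Sq_proper ideal.one_imp_carrier by auto
  then have "(\<exists>i::nat. f [^] i \<in> q) \<longleftrightarrow> (\<exists>i>0::nat. f [^] i \<in> q)"
    by (metis gr0I)
  then show ?thesis
    using True assms unfolding Sq_basic_open_def powers_def ideal_radical_def by blast
qed (simp add: Sq_basic_open_def)

text \<open>The topology is pulled back from the prime spectrum along \<open>q \<mapsto> \<surd>q\<close>, since \<open>U\<^sub>f\<close> consists of
  the \<open>q\<close> whose radical omits \<open>f\<close>.\<close>

lemma openin_Sq_iff:
  "openin (Sq_topology R) U \<longleftrightarrow> U \<subseteq> Sq R \<and>
    (\<forall>q\<in>U. \<exists>f\<in>carrier R. f \<notin> ideal_radical R q \<and>
       (\<forall>q'\<in>Sq R. f \<notin> ideal_radical R q' \<longrightarrow> q' \<in> U))"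
proof -
  have "openin (Sq_topology R) U \<longleftrightarrow>
    (\<forall>q\<in>U. \<exists>V. (\<exists>f\<in>carrier R. V = Sq_basic_open R f) \<and> q \<in> V \<and> V \<subseteq> U)"
    unfolding openin_Sq_topology[OF is_cring] arbitrary_union_of_alt by blast
  also have "\<dots> \<longleftrightarrow> (\<forall>q\<in>U. \<exists>f\<in>carrier R. q \<in> Sq_basic_open R f \<and> Sq_basic_open R f \<subseteq> U)"
    by blast
  also have "\<dots> \<longleftrightarrow> U \<subseteq> Sq R \<and>
    (\<forall>q\<in>U. \<exists>f\<in>carrier R. f \<notin> ideal_radical R q \<and>
       (\<forall>q'\<in>Sq R. f \<notin> ideal_radical R q' \<longrightarrow> q' \<in> U))"
    by (simp add: Sq_basic_open_iff subset_iff Ball_def) blast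
  finally show ?thesis .
qed

lemma openin_Sq_radical:
  assumes "openin (Sq_topology R) U" "q \<in> U"
  shows "ideal_radical R q \<in> U"
proof -
  have q: "q \<in> Sq R" using assms openin_Sq_iff by blast
  note p = quasi_prime_radical_prime[OF q]
  show ?thesis
    using assms prime_in_Sq[OF p] prime_radical[OF p] unfolding openin_Sq_iff by metis
qed

section \<open>Idempotents\<close>

lemma idempotent_compl:
  assumes "e \<in> idempotents R"
  shows "\<one> \<ominus> e \<in> idempotents R" "e \<otimes> (\<one> \<ominus> e) = \<zero>" "e \<oplus> (\<one> \<ominus> e) = \<one>"
proof -
  have c: "e \<in> carrier R" and i: "e \<otimes> e = e" using assms by (auto simp: idempotents_def)
  have "e \<otimes> (\<one> \<ominus> e) = e \<ominus> e \<otimes> e" using c by algebra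
  then show z: "e \<otimes> (\<one> \<ominus> e) = \<zero>" using c i by (simp add: minus_eq r_neg)
  have "(\<one> \<ominus> e) \<otimes> (\<one> \<ominus> e) = (\<one> \<ominus> e) \<ominus> e \<otimes> (\<one> \<ominus> e)" using c by algebra
  then show "\<one> \<ominus> e \<in> idempotents R"
    using c z by (simp add: idempotents_def minus_eq)
  show "e \<oplus> (\<one> \<ominus> e) = \<one>" using c by algebra
qed

lemma idempotent_pow:
  assumes "e \<in> idempotents R" "n > (0::nat)"
  shows "e [^] n = e"
  using assms(2) by (induction n rule: nat_induct_non_zero)
    (use assms(1) in \<open>auto simp: idempotents_def\<close>)

lemma idempotent_mem_radical_iff:
  assumes "e \<in> idempotents R"
  shows "e \<in> ideal_radical R q \<longleftrightarrow> e \<in> q"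
  using assms idempotent_pow[OF assms]
  by (auto simp: ideal_radical_def idempotents_def intro!: exI[of _ 1])

text \<open>The product of \<open>e\<close> and \<open>1 - e\<close> is \<open>0\<close>, so one of them lies in the prime ideal \<open>\<surd>q\<close>; an idempotent
  equals its positive powers, so it lies in \<open>q\<close>. Not both do, as their sum is \<open>1\<close>.\<close>

lemma idempotent_or_compl_mem:
  assumes "q \<in> Sq R" "e \<in> idempotents R"
  shows "e \<in> q \<longleftrightarrow> \<one> \<ominus> e \<notin> q"
proof -
  interpret q: ideal q R using Sq_ideal assms by blast
  have "e \<in> carrier R" "\<one> \<ominus> e \<in> carrier R"
    using assms(2) idempotent_compl(1) by (auto simp: idempotents_def)
  then have "e \<in> q \<or> \<one> \<ominus> e \<in> q"
    using idempotent_compl(2)[OF assms(2)] q.zero_closed assms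
      idempotent_mem_radical_iff idempotent_compl(1)[OF assms(2)]
      primeideal.I_prime[OF quasi_prime_radical_prime[OF assms(1)]]
    by (metis ideal.axioms(1) additive_subgroup.zero_closed
        primeideal.axioms(1) quasi_prime_radical_prime)
  moreover have "\<not> (e \<in> q \<and> \<one> \<ominus> e \<in> q)"
    using ideal_sum_one[OF q.is_ideal] idempotent_compl(3)[OF assms(2)] Sq_proper[OF assms(1)]
    by blast
  ultimately show ?thesis by blast
qed

text \<open>The elements absorbed by some idempotent of the ideal form an ideal containing the generators.
  Closure under addition uses the join \<open>h + k(1 - h)\<close> of two idempotents \<open>h\<close> and \<open>k\<close>, which absorbs
  both.\<close>

lemma regular_ideal_absorbing_idempotent:
  assumes E: "E \<subseteq> idempotents R" and x: "x \<in> Idl E"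
  shows "\<exists>h\<in>idempotents R \<inter> Idl E. x \<otimes> h = x"
proof -
  have Ec: "E \<subseteq> carrier R" using E by (auto simp: idempotents_def)
  interpret M: ideal "Idl E" R by (rule genideal_ideal[OF Ec])
  let ?T = "{x \<in> carrier R. \<exists>h\<in>idempotents R \<inter> Idl E. x \<otimes> h = x}"
  have "ideal ?T R"
  proof (rule idealI[OF ring_axioms])
    show "subgroup ?T (add_monoid R)"
    proof (rule add.subgroupI)
      show "?T \<subseteq> carrier R" by auto
      have "\<zero> \<in> ?T" by (auto simp: idempotents_def intro!: bexI[of _ \<zero>])
      then show "?T \<noteq> {}" by blast
      fix a assume "a \<in> ?T"
      then obtain h where "h \<in> idempotents R \<inter> Idl E" "a \<otimes> h = a" "a \<in> carrier R" by blast
      then show "\<ominus> a \<in> ?T"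
        using M.Icarr by (auto simp: l_minus intro!: bexI[of _ h])
      fix b assume "b \<in> ?T"
      with \<open>a \<in> ?T\<close> obtain h k where
        hk: "h \<in> idempotents R" "k \<in> idempotents R" "h \<in> Idl E" "k \<in> Idl E"
        and eq: "a \<otimes> h = a" "b \<otimes> k = b" and ab: "a \<in> carrier R" "b \<in> carrier R" by blast
      have c: "h \<in> carrier R" "k \<in> carrier R" and i: "h \<otimes> h = h" "k \<otimes> k = k"
        using hk by (auto simp: idempotents_def)
      let ?l = "h \<oplus> k \<otimes> (\<one> \<ominus> h)"
      have lh: "h \<otimes> ?l = h"
      proof -
        have "h \<otimes> ?l = h \<otimes> h \<oplus> k \<otimes> (h \<otimes> (\<one> \<ominus> h))" using c by algebra
        then show ?thesis using idempotent_compl(2)[OF hk(1)] i c by simp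
      qed
      have lk: "k \<otimes> ?l = k"
      proof -
        have "k \<otimes> ?l = k \<otimes> h \<oplus> (k \<otimes> k) \<otimes> (\<one> \<ominus> h)" using c by algebra
        also have "\<dots> = k \<otimes> (h \<oplus> (\<one> \<ominus> h))" using i c by algebra
        finally show ?thesis using idempotent_compl(3)[OF hk(1)] c by simp
      qed
      have lc: "?l \<in> carrier R" using c by simp
      have "(h \<oplus> k \<otimes> w) \<otimes> y = h \<otimes> y \<oplus> (k \<otimes> y) \<otimes> w"
        if "w \<in> carrier R" "y \<in> carrier R" for w y
        using c that by algebra
      then have "?l \<otimes> ?l = h \<otimes> ?l \<oplus> (k \<otimes> ?l) \<otimes> (\<one> \<ominus> h)" using c lc by simp
      then have "?l \<in> idempotents R" using lh lk lc by (simp add: idempotents_def)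
      moreover have "?l \<in> Idl E" using hk c by (auto intro!: M.a_closed M.I_r_closed)
      moreover have "(a \<oplus> b) \<otimes> ?l = a \<oplus> b"
      proof -
        have "(a \<oplus> b) \<otimes> ?l = (a \<otimes> h) \<otimes> ?l \<oplus> (b \<otimes> k) \<otimes> ?l"
          using eq ab lc by (simp add: l_distr)
        also have "\<dots> = a \<otimes> (h \<otimes> ?l) \<oplus> b \<otimes> (k \<otimes> ?l)"
          using ab c lc by (simp only: m_assoc)
        finally show ?thesis using lh lk eq by simp
      qed
      ultimately show "a \<oplus> b \<in> ?T" using ab by auto
    qed
  next
    fix a y assume "a \<in> ?T" and y: "y \<in> carrier R"
    then obtain h where "h \<in> idempotents R \<inter> Idl E" "a \<otimes> h = a" "a \<in> carrier R" by blast
    moreover from this have "h \<in> carrier R" by (simp add: idempotents_def)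
    ultimately show "y \<otimes> a \<in> ?T"
      using y by (auto simp: m_assoc intro!: bexI[of _ h])
    then show "a \<otimes> y \<in> ?T" using y \<open>a \<in> carrier R\<close> by (simp add: m_comm)
  qed
  moreover have "E \<subseteq> ?T"
    using E genideal_self[OF Ec] by (auto simp: idempotents_def)
  ultimately show ?thesis using genideal_minimal x by blast
qed

text \<open>Since \<open>a\<close> and \<open>b\<close> are comaximal, so are their powers with exponent \<open>n + 1\<close>, which gives
  \<open>e + f = 1\<close> with \<open>e\<close> a multiple of the power of \<open>a\<close>, \<open>f\<close> one of the power of \<open>b\<close>, and \<open>ef \<in> M\<close>.
  So \<open>e\<close> is idempotent modulo \<open>M\<close>. If the idempotent \<open>h \<in> M\<close> absorbs \<open>ef\<close>, then multiplying by
  \<open>1 - h\<close> kills \<open>ef\<close> and makes \<open>u = e(1 - h)\<close> idempotent in the ring itself, while \<open>1 - h\<close> is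
  outside every prime above \<open>M\<close>.\<close>

lemma lift_idempotent:
  assumes M: "ideal M R" and absorb: "\<And>x. x \<in> M \<Longrightarrow> \<exists>h\<in>idempotents R \<inter> M. x \<otimes> h = x"
    and ab: "a \<in> carrier R" "b \<in> carrier R" "a \<oplus> b = \<one>"
    and nil: "(a \<otimes> b) [^] (n::nat) \<in> M"
  shows "\<exists>u\<in>idempotents R. \<forall>p. primeideal p R \<longrightarrow> M \<subseteq> p \<longrightarrow> (u \<in> p \<longleftrightarrow> a \<in> p)"
proof -
  interpret M: ideal M R by fact
  \<comment> \<open>The exponent must be positive for \<open>e\<close> to be a multiple of \<open>a\<close>; \<open>n\<close> itself may be \<open>0\<close>.\<close>
  let ?m = "Suc n"
  have pc: "a [^] ?m \<in> carrier R" "b [^] ?m \<in> carrier R" using ab by auto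
  have not_both: False if "primeideal p R" "a \<in> p" "b \<in> p" for p
  proof -
    interpret primeideal p R by fact
    show False using that ab(3) prime_not_one[OF that(1)] a_closed[of a b] by simp
  qed
  have pow_in: "x \<in> p" if "primeideal p R" "x \<in> carrier R" "PIdl (x [^] ?m) \<subseteq> p" for p x
  proof -
    have "x [^] ?m \<in> p" using that cgenideal_self[of "x [^] ?m"] by auto
    then show ?thesis using primeideal.pow_mem_iff[OF that(1,2), of ?m] by blast
  qed
  have no_common: False
    if "primeideal p R" "PIdl (a [^] ?m) \<subseteq> p" "PIdl (b [^] ?m) \<subseteq> p" for p
    using not_both[OF that(1) pow_in[OF that(1) ab(1) that(2)] pow_in[OF that(1) ab(2) that(3)]] .
  obtain e f where "e \<in> PIdl (a [^] ?m)" "f \<in> PIdl (b [^] ?m)" and ef: "e \<oplus> f = \<one>"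
    using comaximal_if_no_common_prime[OF cgenideal_ideal[OF pc(1)] cgenideal_ideal[OF pc(2)]]
      no_common by metis
  then obtain r s where rs: "r \<in> carrier R" "s \<in> carrier R"
    and e: "e = r \<otimes> a [^] ?m" and f: "f = s \<otimes> b [^] ?m"
    by (auto simp: cgenideal_def)
  have c: "e \<in> carrier R" "f \<in> carrier R" using e f rs pc by auto
  have "e \<otimes> f = (r \<otimes> s) \<otimes> (a [^] ?m \<otimes> b [^] ?m)"
    unfolding e f using rs pc by algebra
  also have "\<dots> = (r \<otimes> s \<otimes> (a \<otimes> b)) \<otimes> (a \<otimes> b) [^] n"
    using ab rs by (simp add: nat_pow_distrib[symmetric] m_ac)
  also have "\<dots> \<in> M" using nil rs ab by (intro M.I_l_closed) auto
  finally obtain h where h: "h \<in> idempotents R" "h \<in> M" and efh: "(e \<otimes> f) \<otimes> h = e \<otimes> f"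
    using absorb by blast
  let ?k = "\<one> \<ominus> h"
  let ?u = "e \<otimes> ?k"
  have hc: "h \<in> carrier R" using h by (simp add: idempotents_def)
  have efk: "(e \<otimes> f) \<otimes> ?k = \<zero>"
  proof -
    have "(e \<otimes> f) \<otimes> ?k = e \<otimes> f \<ominus> (e \<otimes> f) \<otimes> h" using c hc by algebra
    then show ?thesis using efh c by (simp add: minus_eq r_neg)
  qed
  have kk: "?k \<otimes> ?k = ?k" using idempotent_compl(1)[OF h(1)] by (simp add: idempotents_def)
  have "?u \<otimes> ?u = (e \<otimes> e) \<otimes> (?k \<otimes> ?k) \<oplus> (e \<otimes> f) \<otimes> ?k"
    unfolding efk using c hc by (simp add: m_ac)
  also have "\<dots> = (e \<otimes> ?k) \<otimes> (e \<oplus> f)" unfolding kk using c hc by algebra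
  finally have "?u \<in> idempotents R" using ef c hc by (simp add: idempotents_def)
  moreover have "?u \<in> p \<longleftrightarrow> a \<in> p" if p: "primeideal p R" "M \<subseteq> p" for p
  proof -
    interpret p: primeideal p R by fact
    have k: "?k \<notin> p"
      using h p prime_not_one[OF p(1)] idempotent_compl(3)[OF h(1)] p.a_closed[of h ?k] by auto
    show ?thesis
    proof
      assume "a \<in> p"
      then have "a [^] ?m \<in> p" using p.pow_mem_iff ab by blast
      then show "?u \<in> p"
        unfolding e using rs hc p.I_l_closed p.I_r_closed minus_closed one_closed by metis
    next
      assume "?u \<in> p"
      then have "e \<in> p" using p.I_prime[of e ?k] k c hc by auto
      then have "f \<notin> p"
        using ef prime_not_one[OF p(1)] p.a_closed[of e f] by auto
      then have "b \<notin> p"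
        using f rs p.pow_mem_iff[of b ?m] ab p.I_l_closed by blast
      \<comment> \<open>If \<open>n = 0\<close>, the hypothesis puts \<open>1\<close> into \<open>M\<close> and no prime lies above it.\<close>
      moreover have "a \<otimes> b \<in> p"
      proof (cases "n = 0")
        case True
        then show ?thesis using nil p prime_not_one[OF p(1)] by auto
      next
        case False
        then show ?thesis using nil p p.pow_mem_iff[of "a \<otimes> b" n] ab by auto
      qed
      ultimately show "a \<in> p" using p.I_prime ab by blast
    qed
  qed
  ultimately show ?thesis by blast
qed

section \<open>Max-regular ideals\<close>

lemma regular_ideal_ideal: "regular_ideal R J \<Longrightarrow> ideal J R"
  unfolding regular_ideal_def by (auto intro!: genideal_ideal simp: idempotents_def)

definition idempotent_core :: "'a set \<Rightarrow> 'a set" where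
  "idempotent_core q = Idl (idempotents R \<inter> q)"

lemma ideal_idempotent_core: "ideal (idempotent_core q) R"
  unfolding idempotent_core_def by (rule genideal_ideal) (auto simp: idempotents_def)

lemma mem_idempotent_core: "e \<in> idempotents R \<Longrightarrow> e \<in> q \<Longrightarrow> e \<in> idempotent_core q"
  unfolding idempotent_core_def
  using genideal_self[of "idempotents R \<inter> q"] by (auto simp: idempotents_def)

lemma idempotent_core_subset_iff:
  assumes "ideal I R"
  shows "idempotent_core q \<subseteq> I \<longleftrightarrow> idempotents R \<inter> q \<subseteq> I"
  unfolding idempotent_core_def by (rule Idl_subset_ideal[OF assms]) (auto simp: idempotents_def)

lemma regular_idempotent_core: "regular_ideal R (idempotent_core q)"
  unfolding regular_ideal_def idempotent_core_def by blast

text \<open>A regular ideal is generated by the idempotents that it contains.\<close>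

lemma regular_subset_idempotent_core:
  assumes "regular_ideal R J" "idempotents R \<inter> J \<subseteq> q"
  shows "J \<subseteq> idempotent_core q"
proof -
  obtain E where E: "E \<subseteq> idempotents R" "J = Idl E"
    using assms(1) by (auto simp: regular_ideal_def)
  then have "E \<subseteq> J" using genideal_self[of E] by (auto simp: idempotents_def)
  then have "E \<subseteq> idempotent_core q" using E assms(2) mem_idempotent_core by blast
  then show ?thesis unfolding E(2) by (rule genideal_minimal[OF ideal_idempotent_core])
qed

lemma idempotent_core_proper:
  assumes "q \<in> Sq R"
  shows "idempotent_core q \<noteq> carrier R"
proof -
  have "idempotent_core q \<subseteq> q"
    using idempotent_core_subset_iff[OF Sq_ideal[OF assms]] by simp
  then show ?thesis
    using Sq_proper[OF assms] ideal.Icarr[OF Sq_ideal[OF assms]] by auto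
qed

text \<open>A proper ideal above \<open>J(q)\<close> cannot contain an idempotent \<open>e\<close> outside \<open>q\<close>, because \<open>1 - e\<close>
  already lies in \<open>J(q)\<close>.\<close>

lemma max_regular_idempotent_core:
  assumes q: "q \<in> Sq R"
  shows "max_regular_ideal R (idempotent_core q)"
  unfolding max_regular_ideal_def
proof (intro conjI allI impI)
  show "regular_ideal R (idempotent_core q)" by (rule regular_idempotent_core)
  show "idempotent_core q \<noteq> carrier R" by (rule idempotent_core_proper[OF q])
  fix J assume J: "regular_ideal R J \<and> J \<noteq> carrier R \<and> idempotent_core q \<subseteq> J"
  then have ideal: "ideal J R"
    using regular_ideal_ideal by blast
  have "e \<in> q" if e: "e \<in> idempotents R" "e \<in> J" for e
  proof (rule ccontr)
    assume "e \<notin> q"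
    then have "\<one> \<ominus> e \<in> J"
      using idempotent_or_compl_mem[OF q e(1)] mem_idempotent_core idempotent_compl(1)[OF e(1)] J
      by blast
    then show False using ideal_sum_one[OF ideal e(2)] idempotent_compl(3)[OF e(1)] J by blast
  qed
  then show "J = idempotent_core q" using regular_subset_idempotent_core J by blast
qed

text \<open>For the forward direction, choose any prime \<open>p\<close> above \<open>M\<close>: then \<open>M \<subseteq> J(p)\<close>, and maximality
  forces equality.\<close>

lemma max_regular_iff_idempotent_core:
  "max_regular_ideal R M \<longleftrightarrow> (\<exists>q\<in>Sq R. M = idempotent_core q)"
proof
  assume M: "max_regular_ideal R M"
  then have reg: "regular_ideal R M" and "M \<noteq> carrier R" by (auto simp: max_regular_ideal_def)
  then have ideal: "ideal M R"
    using regular_ideal_ideal by blast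
  obtain p where p: "primeideal p R" "M \<subseteq> p"
    using ideal_radical_eq_Inter_primes(2)[OF ideal \<open>M \<noteq> carrier R\<close>] by blast
  have "M \<subseteq> idempotent_core p" using regular_subset_idempotent_core[OF reg] p by blast
  then show "\<exists>q\<in>Sq R. M = idempotent_core q"
    using M prime_in_Sq[OF p(1)] regular_idempotent_core idempotent_core_proper
    unfolding max_regular_ideal_def by metis
qed (use max_regular_idempotent_core in blast)

section \<open>The connected components\<close>

lemma Sq_V_idempotent_core:
  "q' \<in> Sq_V R (idempotent_core q) \<longleftrightarrow> q' \<in> Sq R \<and> idempotents R \<inter> q \<subseteq> q'"
proof (cases "q' \<in> Sq R")
  case True
  then have "ideal (ideal_radical R q') R"
    using quasi_prime_radical_prime primeideal.axioms(1) by blast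
  then show ?thesis
    using True idempotent_core_subset_iff[of "ideal_radical R q'" q]
      idempotent_mem_radical_iff[of _ q'] unfolding Sq_V_def by blast
qed (simp add: Sq_V_def)

text \<open>The ideal \<open>J(q)\<close> contains \<open>e\<close> or \<open>1 - e\<close> for each idempotent \<open>e\<close>, so the quotient by it has no
  nontrivial idempotents; the proof carries the classical argument for the prime spectrum of such a
  quotient over to \<open>\<V>(J(q))\<close>.\<close>

lemma connectedin_Sq_V_idempotent_core:
  assumes q: "q \<in> Sq R"
  shows "connectedin (Sq_topology R) (Sq_V R (idempotent_core q))"
proof -
  let ?M = "idempotent_core q"
  let ?P = "{p. primeideal p R \<and> ?M \<subseteq> p}"
  have M: "ideal ?M R" by (rule ideal_idempotent_core)
  interpret M: ideal ?M R by fact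
  have PV: "p \<in> Sq_V R ?M" if "p \<in> ?P" for p
    using that prime_in_Sq[of p] prime_radical[of p] by (simp add: Sq_V_def)
  have absorb: "\<exists>h\<in>idempotents R \<inter> ?M. x \<otimes> h = x" if "x \<in> ?M" for x
    using regular_ideal_absorbing_idempotent[of "idempotents R \<inter> q"] that
    unfolding idempotent_core_def by blast
  have False if U: "openin (Sq_topology R) U" and W: "openin (Sq_topology R) W"
    and cover: "Sq_V R ?M \<subseteq> U \<union> W" and disj: "U \<inter> W \<inter> Sq_V R ?M = {}"
    and ne: "U \<inter> Sq_V R ?M \<noteq> {}" "W \<inter> Sq_V R ?M \<noteq> {}" for U W
  proof -
    \<comment> \<open>\<open>Z T\<close> is the intersection of the primes above \<open>M\<close> lying outside \<open>T\<close>; intersecting with the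
    carrier covers the case that there are none.\<close>
    define Z where "Z T = carrier R \<inter> \<Inter>{p \<in> ?P. p \<notin> T}" for T
    have Z: "ideal (Z T) R" for T
    proof -
      have "ideal (\<Inter>(insert (carrier R) {p \<in> ?P. p \<notin> T})) R"
        by (rule i_Intersect) (auto intro: oneideal primeideal.axioms(1))
      then show ?thesis by (simp add: Z_def)
    qed
    have MZ: "?M \<subseteq> Z T" for T using M.Icarr by (auto simp: Z_def)
    \<comment> \<open>For open \<open>T\<close>, the primes above \<open>M\<close> that contain \<open>Z T\<close> are exactly those outside \<open>T\<close>.\<close>
    have Z_prime: "\<not> Z T \<subseteq> p" if T: "openin (Sq_topology R) T" and p: "p \<in> ?P" "p \<in> T" for T p
    proof -
      have "\<exists>f\<in>carrier R. f \<notin> ideal_radical R p \<and>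
          (\<forall>q'\<in>Sq R. f \<notin> ideal_radical R q' \<longrightarrow> q' \<in> T)"
        using T p(2) unfolding openin_Sq_iff by blast
      then obtain f where f: "f \<in> carrier R" "f \<notin> p"
        and fT: "\<And>q'. q' \<in> Sq R \<Longrightarrow> f \<notin> ideal_radical R q' \<Longrightarrow> q' \<in> T"
        using p(1) prime_radical[of p] by auto
      have "f \<in> p'" if "p' \<in> ?P" "p' \<notin> T" for p'
        using fT[of p'] that prime_in_Sq[of p'] prime_radical[of p'] by auto
      then have "f \<in> Z T"
        using f(1) by (auto simp: Z_def)
      then show ?thesis using f by blast
    qed
    have no_common: False if p: "primeideal p R" "Z U \<subseteq> p" "Z W \<subseteq> p" for p
    proof -
      have "p \<in> ?P" using p(1,2) MZ[of U] by auto
      moreover from this have "p \<in> U \<or> p \<in> W" using PV[of p] cover by auto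
      ultimately show False using Z_prime[OF U, of p] Z_prime[OF W, of p] p by auto
    qed
    obtain a b where ab: "a \<in> Z U" "b \<in> Z W" "a \<oplus> b = \<one>"
      using comaximal_if_no_common_prime[OF Z[of U] Z[of W]] no_common by metis
    have c: "a \<in> carrier R" "b \<in> carrier R" using ab by (auto simp: Z_def)
    have "a \<otimes> b \<in> p" if "p \<in> ?P" for p
    proof -
      interpret p: primeideal p R using that by blast
      have "p \<notin> U \<or> p \<notin> W" using PV[OF that] disj by auto
      then have "a \<in> p \<or> b \<in> p" using that ab by (auto simp: Z_def)
      then show ?thesis using c p.I_l_closed[of b a] p.I_r_closed[of a b] by auto
    qed
    then have "a \<otimes> b \<in> ideal_radical R ?M"
      unfolding ideal_radical_eq_Inter_primes(1)[OF M idempotent_core_proper[OF q]] by auto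
    then obtain n :: nat where "(a \<otimes> b) [^] n \<in> ?M" by (auto simp: ideal_radical_def)
    then have "\<exists>u\<in>idempotents R. \<forall>p. primeideal p R \<longrightarrow> ?M \<subseteq> p \<longrightarrow> (u \<in> p \<longleftrightarrow> a \<in> p)"
      using absorb by (intro lift_idempotent[OF M _ c ab(3)])
    then obtain u where u: "u \<in> idempotents R" "\<And>p. p \<in> ?P \<Longrightarrow> u \<in> p \<longleftrightarrow> a \<in> p"
      by auto
    have rad: "ideal_radical R q' \<in> ?P" if "q' \<in> Sq_V R ?M" for q'
      using that quasi_prime_radical_prime[of q'] by (simp add: Sq_V_def)
    have meets: "\<exists>p\<in>?P. p \<in> T" if "openin (Sq_topology R) T" "T \<inter> Sq_V R ?M \<noteq> {}" for T
      using that(2) rad openin_Sq_radical[OF that(1)] by (metis disjoint_iff)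
    obtain p where p: "p \<in> ?P" "p \<in> U" using meets[OF U ne(1)] by (rule bexE)
    obtain p' where p': "p' \<in> ?P" "p' \<in> W" using meets[OF W ne(2)] by (rule bexE)
    show False
    proof (cases "u \<in> q")
      case True
      \<comment> \<open>Then \<open>a\<close> lies in all primes above \<open>M\<close>, contradicting the prime \<open>p\<close> in \<open>U\<close>, which contains \<open>b\<close>.\<close>
      then have "u \<in> p" using mem_idempotent_core[OF u(1)] p(1) by auto
      then have "a \<in> p" using u(2)[OF p(1)] by simp
      moreover have "p \<notin> W" using p(2) PV[OF p(1)] disj by auto
      then have "b \<in> p" using p(1) ab by (auto simp: Z_def)
      moreover have p_prime: "primeideal p R" using p(1) by simp
      ultimately have "p = carrier R"
        using ideal_sum_one[OF primeideal.axioms(1) _ _ ab(3)] by simp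
      then show False using prime_not_one[OF p_prime] by simp
    next
      case False
      \<comment> \<open>Then \<open>a\<close> lies in no prime above \<open>M\<close>, contradicting the prime \<open>p'\<close> in \<open>W\<close>.\<close>
      then have "\<one> \<ominus> u \<in> ?M"
        using idempotent_or_compl_mem[OF q u(1)]
          mem_idempotent_core[OF idempotent_compl(1)[OF u(1)]] by simp
      then have "\<one> \<ominus> u \<in> p'" using p'(1) by auto
      then have "u \<notin> p'"
        using idempotent_or_compl_mem[OF prime_in_Sq u(1)] p'(1) by simp
      then have "a \<notin> p'" using u(2)[OF p'(1)] by simp
      moreover have "p' \<notin> U" using p'(2) PV[OF p'(1)] disj by auto
      then have "a \<in> p'" using p'(1) ab by (auto simp: Z_def)
      ultimately show False by simp
    qed
  qed
  moreover have "Sq_V R ?M \<subseteq> topspace (Sq_topology R)"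
    by (auto simp: Sq_V_def topspace_Sq_topology[OF is_cring])
  ultimately show ?thesis unfolding connectedin by blast
qed

text \<open>The basic open sets of \<open>e\<close> and \<open>1 - e\<close> partition the spectrum, so \<open>C\<close> lies in one of them.\<close>

lemma idempotent_in_component:
  assumes e: "e \<in> idempotents R" "e \<in> q"
    and C: "connectedin (Sq_topology R) C" "q \<in> C" "q' \<in> C"
  shows "e \<in> q'"
proof -
  have sub: "C \<subseteq> Sq R"
    using C(1) connectedin_subset_topspace topspace_Sq_topology[OF is_cring] by blast
  have open_basic: "openin (Sq_topology R) (Sq_basic_open R f)" if "f \<in> carrier R" for f
    using that unfolding openin_Sq_iff by (auto simp: Sq_basic_open_iff)
  have mem: "r \<in> Sq_basic_open R f \<longleftrightarrow> r \<in> Sq R \<and> f \<notin> r" if "f \<in> idempotents R" for f r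
    using that Sq_basic_open_iff[of f r] idempotent_mem_radical_iff[OF that]
    by (simp add: idempotents_def)
  let ?k = "\<one> \<ominus> e"
  note k = idempotent_compl(1)[OF e(1)]
  have "openin (Sq_topology R) (Sq_basic_open R e)" "openin (Sq_topology R) (Sq_basic_open R ?k)"
    using e(1) k open_basic by (auto simp: idempotents_def)
  moreover have "C \<subseteq> Sq_basic_open R ?k \<union> Sq_basic_open R e"
    "Sq_basic_open R ?k \<inter> Sq_basic_open R e = {}"
    using sub idempotent_or_compl_mem[OF _ e(1)] by (auto simp: mem[OF k] mem[OF e(1)])
  moreover have "q \<in> Sq_basic_open R ?k"
    using C(2) sub e idempotent_or_compl_mem[OF _ e(1)] by (auto simp: mem[OF k])
  ultimately have "q' \<notin> Sq_basic_open R e"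
    using C unfolding connectedin by blast
  then show ?thesis using C(3) sub by (auto simp: mem[OF e(1)])
qed

lemma component_of_quasi_prime:
  assumes q: "q \<in> Sq R"
  shows "connected_component_of_set (Sq_topology R) q = Sq_V R (idempotent_core q)"
proof
  show "Sq_V R (idempotent_core q) \<subseteq> connected_component_of_set (Sq_topology R) q"
    by (rule connected_component_of_maximal[OF connectedin_Sq_V_idempotent_core[OF q]])
      (simp add: Sq_V_idempotent_core q)
  show "connected_component_of_set (Sq_topology R) q \<subseteq> Sq_V R (idempotent_core q)"
  proof
    fix q' assume "q' \<in> connected_component_of_set (Sq_topology R) q"
    then obtain C where C: "connectedin (Sq_topology R) C" "q \<in> C" "q' \<in> C"
      by (auto simp: connected_component_of_def)
    then have "q' \<in> Sq R"
      using connectedin_subset_topspace[OF C(1)] topspace_Sq_topology[OF is_cring] by auto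
    then show "q' \<in> Sq_V R (idempotent_core q)"
      unfolding Sq_V_idempotent_core using idempotent_in_component[OF _ _ C] by auto
  qed
qed

end

theorem theorem3p7:
  fixes A :: "('a, 'm) ring_scheme"
  assumes "cring A"
  shows "connected_components_of (Sq_topology A) = {Sq_V A M |M. max_regular_ideal A M}"
proof -
  interpret cring A by fact
  show ?thesis
    unfolding connected_components_of_def topspace_Sq_topology[OF assms]
      max_regular_iff_idempotent_core
    using component_of_quasi_prime by (auto simp: image_iff)
qed

end
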